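(* Let $m,n$ be integers with $m\ge 3$, $n\ge 3$ and $n\ge 2m-1$. Then $$\binom n{\lfloor n/m\rfloor}<\frac m{\sqrt{2\pi (m-1)n}}\left(\frac{m}{(m-1)^{\frac{m-1}m}}\right)^n.$$
   Context: $\lfloor x\rfloor$ denotes the greatest integer not exceeding $x$. *)

theory Defs
  imports "HOL-Analysis.Analysis"
begin

end

theory Submission
  imports Defs
begin

text \<open>
  Write \<open>ln n! = (n + 1/2) ln n - n + ln (2\<pi>) / 2 + g n\<close>. The gap \<open>g\<close> is strictly decreasing with
  limit 0 (by Wallis' product), so \<open>g n < g k + g (n - k)\<close>, which is the strict bound of
  \<open>n choose k\<close> by its Stirling approximation. For \<open>k = \<lfloor>n/m\<rfloor> = n/m - t\<close>, Gibbs' inequality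
  for the distributions \<open>(k/n, 1 - k/n)\<close> and \<open>(1/m, 1 - 1/m)\<close> shows that the exponential part of
  this approximation is at most \<open>(m - 1) powr - t\<close> times the one at \<open>n/m\<close>. The square root part
  exceeds the one at \<open>n/m\<close> at most by the factor \<open>exp (t/2)\<close>, and \<open>1/2 < ln 2 \<le> ln (m - 1)\<close>.
\<close>

definition stirling_gap :: "nat \<Rightarrow> real" where
  "stirling_gap n = ln (fact n) - (real n + 1/2) * ln (real n) + real n - ln (2 * pi) / 2"

lemma stirling_gap_diff:
  assumes "n > 0"
  shows "stirling_gap n - stirling_gap (Suc n)
    = (real n + 1/2) * (ln (real n + 1) - ln (real n)) - 1"
proof -
  have "ln (fact (Suc n) :: real) = ln (real n + 1) + ln (fact n)"
    by (simp add: ln_mult add.commute)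
  then show ?thesis
    unfolding stirling_gap_def by (simp add: algebra_simps)
qed

lemma stirling_gap_Suc_less:
  assumes "n > 0"
  shows "stirling_gap (Suc n) < stirling_gap n"
proof -
  define x where "x = real n"
  have x: "x > 0" using assms by (simp add: x_def)
  \<comment> \<open>The midpoint bound for \<open>ln\<close> is not strict; bisecting the interval makes it so.\<close>
  have "2 / (4*x + 1) \<le> ln (x + 1/2) - ln x"
    using ln_inverse_approx_ge[of x "x + 1/2"] x by (simp add: field_simps)
  moreover have "2 / (4*x + 3) \<le> ln (x + 1) - ln (x + 1/2)"
    using ln_inverse_approx_ge[of "x + 1/2" "x + 1"] x by (simp add: field_simps)
  moreover have "1 / (x + 1/2) < 2 / (4*x + 1) + 2 / (4*x + 3)"
  proof -
    have "2 / (4*x + 1) + 2 / (4*x + 3) = 1 / (x + 1/2) + 4 / ((4*x + 1) * (4*x + 2) * (4*x + 3))"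
      using x by (simp add: divide_simps add_pos_pos) (simp add: algebra_simps)
    moreover have "4 / ((4*x + 1) * (4*x + 2) * (4*x + 3)) > 0"
      using x by simp
    ultimately show ?thesis by linarith
  qed
  ultimately have "1 / (x + 1/2) < ln (x + 1) - ln x"
    by linarith
  then have "1 < (x + 1/2) * (ln (x + 1) - ln x)"
    using x by (simp add: field_simps)
  then show ?thesis
    using stirling_gap_diff[OF assms] by (simp add: x_def)
qed

text \<open>Since 1/x is convex, the trapezoidal rule overestimates its integral
  \<open>ln (x + 1) - ln x\<close>. The resulting bound telescopes, which keeps the decreasing gap
  bounded below.\<close>

lemma stirling_gap_diff_le:
  assumes "n > 0"
  shows "stirling_gap n - stirling_gap (Suc n) \<le> 1 / (4 * real n) - 1 / (4 * real (Suc n))"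
proof -
  define x where "x = real n"
  have x: "x > 0" using assms by (simp add: x_def)
  have "ln (x + 1) - ln x \<le> (inverse x + inverse (x + 1)) / 2"
    using ln_inverse_approx_le[of x 1] x by simp
  then have "(x + 1/2) * (ln (x + 1) - ln x) \<le> (x + 1/2) * ((inverse x + inverse (x + 1)) / 2)"
    using x by (intro mult_left_mono) auto
  also have "\<dots> = 1 + 1 / (4 * x) - 1 / (4 * (x + 1))"
    using x by (simp add: divide_simps) (simp add: algebra_simps)
  finally show ?thesis
    using stirling_gap_diff[OF assms] by (simp add: x_def add.commute)
qed

lemma stirling_gap_strict_antimono:
  assumes "0 < k" "k < n"
  shows "stirling_gap n < stirling_gap k"
  using \<open>k < n\<close>
proof (induction n rule: less_induct)
  case (less n)
  then obtain j where j: "n = Suc j" "k \<le> j" by (cases n) auto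
  then show ?case
    using less.IH[of j] stirling_gap_Suc_less[of j] assms(1) by (cases "k = j") auto
qed

lemma convergent_stirling_gap: "convergent stirling_gap"
proof -
  \<comment> \<open>The shift skips index 0: there \<open>ln 0 = 0\<close> makes the gap
    \<open>- ln (2 * pi) / 2\<close>, which breaks monotonicity.\<close>
  have "decseq (\<lambda>n. stirling_gap (Suc n))"
    by (rule decseq_SucI) (simp add: stirling_gap_Suc_less less_imp_le)
  moreover have "\<forall>n. stirling_gap 1 - 1/4 \<le> stirling_gap (Suc n)"
  proof
    fix n
    have "incseq (\<lambda>n. stirling_gap (Suc n) - 1 / (4 * real (Suc n)))"
      using stirling_gap_diff_le by (intro incseq_SucI) (smt (verit) zero_less_Suc)
    from incseqD[OF this, of 0 n]
    have "stirling_gap 1 - 1/4 \<le> stirling_gap (Suc n) - 1 / (4 * real (Suc n))"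
      by simp
    also have "\<dots> \<le> stirling_gap (Suc n)" by simp
    finally show "stirling_gap 1 - 1/4 \<le> stirling_gap (Suc n)" .
  qed
  ultimately obtain L where "(\<lambda>n. stirling_gap (Suc n)) \<longlonglongrightarrow> L"
    by (rule decseq_convergent)
  then show ?thesis
    using LIMSEQ_imp_Suc by (auto simp: convergent_def)
qed

text \<open>The denominators are \<open>(2*k - 1) * (2*k + 1)\<close>, so their product is
  \<open>2*n + 1\<close> times the square of 1 * 3 * ... * (2*n - 1), which is
  \<open>fact (2*n) / (2^n * fact n)\<close>.\<close>

lemma wallis_product_eq_fact:
  "(\<Prod>k=1..n. (4 * real k^2) / (4 * real k^2 - 1))
    = (4^n * fact n^2)^2 / (fact (2*n)^2 * (2 * real n + 1))"
proof (induction n)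
  case (Suc n)
  define x p f g where "x = real n" and "p = (4::real)^n" and "f = (fact n :: real)"
    and "g = (fact (2*n) :: real)"
  have "(\<Prod>k=1..Suc n. (4 * real k^2) / (4 * real k^2 - 1))
      = (p * f^2)^2 / (g^2 * (2*x + 1)) * (4 * (x + 1)^2 / (4 * (x + 1)^2 - 1))"
    using Suc.IH by (simp add: x_def p_def f_def g_def add.commute)
  also have "4 * (x + 1)^2 - 1 = (2*x + 1) * (2*x + 3)"
    by (simp add: algebra_simps power2_eq_square)
  also have "(p * f^2)^2 / (g^2 * (2*x + 1)) * (4 * (x + 1)^2 / ((2*x + 1) * (2*x + 3)))
      = (4 * p * ((x + 1) * f)^2)^2 / (((2*x + 2) * (2*x + 1) * g)^2 * (2*x + 3))"
  proof -
    have "g \<noteq> 0" "2*x + 1 \<noteq> 0" "2*x + 3 \<noteq> 0" "x + 1 \<noteq> 0"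
      by (auto simp: g_def x_def add_eq_0_iff)
    moreover have "(2*x + 2) * (2*x + 2) = 4 * ((x + 1) * (x + 1))"
      by (simp add: algebra_simps)
    ultimately show ?thesis by (simp add: divide_simps power2_eq_square)
  qed
  finally show ?case
    by (simp add: x_def p_def f_def g_def algebra_simps)
qed simp

text \<open>In \<open>2 * stirling_gap n - stirling_gap (2*n)\<close> the terms of order n ln n and
  n ln 2 combine so that only the central ratio \<open>4^n * fact n^2 / fact (2*n)\<close> and a
  root of n survive. Doubling turns this ratio into its square, as in Wallis' product.\<close>

lemma double_stirling_gap_diff:
  assumes "n > 0"
  shows "2 * (2 * stirling_gap n - stirling_gap (2*n))
    = ln (\<Prod>k=1..n. (4 * real k^2) / (4 * real k^2 - 1)) + ln (2 + 1 / real n) - ln pi"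
proof -
  have "ln (\<Prod>k=1..n. (4 * real k^2) / (4 * real k^2 - 1))
    = 2 * (real n * ln 4 + 2 * ln (fact n)) - (2 * ln (fact (2*n)) + ln (2 * real n + 1))"
    unfolding wallis_product_eq_fact
    by (simp add: ln_div ln_mult ln_realpow add_pos_nonneg)
  moreover have "2 + 1 / real n = (2 * real n + 1) / real n"
    using assms by (simp add: field_simps)
  then have "ln (2 + 1 / real n) = ln (2 * real n + 1) - ln (real n)"
    using assms by (simp add: ln_div add_pos_nonneg)
  moreover have "ln (4::real) = 2 * ln 2"
    using ln_realpow[of 2 2] by simp
  moreover have "ln (real (2 * n)) = ln 2 + ln (real n)"
    using assms by (simp add: ln_mult)
  moreover have "ln (2 * pi) = ln 2 + ln pi"
    by (simp add: ln_mult)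
  ultimately show ?thesis
    unfolding stirling_gap_def by (simp add: algebra_simps add_divide_distrib)
qed

lemma stirling_gap_tendsto_0: "stirling_gap \<longlonglongrightarrow> 0"
proof -
  obtain L where L: "stirling_gap \<longlonglongrightarrow> L"
    using convergent_stirling_gap by (auto simp: convergent_def)
  have "(\<lambda>n. stirling_gap (2*n)) \<longlonglongrightarrow> L"
    using LIMSEQ_subseq_LIMSEQ[OF L, of "\<lambda>n. 2*n"] by (simp add: strict_mono_def o_def)
  \<comment> \<open>As \<open>2 * L - L = L\<close>, this combination determines the limit of the
    gap itself.\<close>
  then have lim1: "(\<lambda>n. 2 * (2 * stirling_gap n - stirling_gap (2*n))) \<longlonglongrightarrow> 2 * (2 * L - L)"
    by (intro tendsto_intros L)
  have "(\<lambda>n. 2 + 1 / real n) \<longlonglongrightarrow> 2 + 0"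
    by (intro tendsto_intros lim_1_over_n)
  then have "(\<lambda>n. ln (\<Prod>k=1..n. (4 * real k^2) / (4 * real k^2 - 1)) + ln (2 + 1 / real n) - ln pi)
      \<longlonglongrightarrow> ln (pi / 2) + ln (2 + 0) - ln pi"
    by (intro tendsto_intros wallis) auto
  moreover have "ln (pi / 2) + ln (2 + 0) - ln pi = 0"
    by (simp add: ln_div)
  moreover have "eventually (\<lambda>n. ln (\<Prod>k=1..n. (4 * real k^2) / (4 * real k^2 - 1))
      + ln (2 + 1 / real n) - ln pi = 2 * (2 * stirling_gap n - stirling_gap (2*n))) sequentially"
    using eventually_gt_at_top[of 0] by eventually_elim (simp only: double_stirling_gap_diff)
  ultimately have "(\<lambda>n. 2 * (2 * stirling_gap n - stirling_gap (2*n))) \<longlonglongrightarrow> 0"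
    by (simp add: tendsto_cong)
  from LIMSEQ_unique[OF lim1 this] L show ?thesis by simp
qed

lemma stirling_gap_nonneg:
  assumes "n > 0"
  shows "stirling_gap n \<ge> 0"
proof (rule LIMSEQ_le_const2[OF stirling_gap_tendsto_0])
  show "\<exists>N. \<forall>j\<ge>N. stirling_gap j \<le> stirling_gap n"
    using stirling_gap_strict_antimono[OF assms]
    by (intro exI[of _ n]) (metis le_less)
qed

lemma ln_binomial_less_stirling:
  assumes "0 < k" "k < n"
  shows "ln (real (n choose k)) < (real n + 1/2) * ln (real n) - (real k + 1/2) * ln (real k)
    - (real (n - k) + 1/2) * ln (real (n - k)) - ln (2 * pi) / 2"
proof -
  have "real (n choose k) = fact n / (fact k * fact (n - k))"
    using assms by (simp add: binomial_fact)
  then have "ln (real (n choose k)) = ln (fact n) - ln (fact k) - ln (fact (n - k))"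
    by (simp add: ln_div ln_mult)
  moreover have "stirling_gap n < stirling_gap k"
    using assms by (rule stirling_gap_strict_antimono)
  moreover have "stirling_gap (n - k) \<ge> 0"
    using assms by (intro stirling_gap_nonneg) simp
  ultimately show ?thesis
    unfolding stirling_gap_def using assms by (simp add: of_nat_diff)
qed

lemma stirling_exponent_le:
  fixes m n k :: real
  assumes "m \<ge> 3" "k \<ge> 1" "k \<le> n / m"
  shows "(n + 1/2) * ln n - (k + 1/2) * ln k - (n - k + 1/2) * ln (n - k)
    \<le> ln m - (ln (m - 1) + ln n) / 2 + n * (ln m - (m - 1) / m * ln (m - 1))"
proof -
  define x where "x = n / m"
  define t where "t = x - k"
  have x: "x \<ge> 1" unfolding x_def using assms by linarith
  have n: "n = m * x" and t: "t \<ge> 0" and x_eq: "x = k + t"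
    using assms by (auto simp: x_def t_def)
  have "n - k = (m - 1) * x + t"
    by (simp add: n t_def algebra_simps)
  then have nk: "n - k \<ge> (m - 1) * x" "(m - 1) * x > 0"
    using assms x t by auto
  have ln_n: "ln n = ln m + ln x"
    using assms x by (simp add: n ln_mult)
  have ln_nx: "ln ((m - 1) * x) = ln (m - 1) + ln x"
    using assms x by (simp add: ln_mult)
  \<comment> \<open>\<open>k1\<close> and \<open>k2\<close> are the two summands of Gibbs'
    inequality; their bounds \<open>t\<close> and \<open>- t\<close> cancel when added.\<close>
  have "ln x - ln k \<le> x / k - 1"
    using assms x ln_le_minus_one[of "x / k"] by (simp add: ln_div)
  then have k1: "k * (ln x - ln k) \<le> t"
    using assms by (simp add: t_def field_simps)
  have "ln ((m - 1) * x) - ln (n - k) \<le> (m - 1) * x / (n - k) - 1"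
    using nk ln_le_minus_one[of "(m - 1) * x / (n - k)"]
    by (auto simp: ln_div split: if_splits)
  then have "(n - k) * (ln ((m - 1) * x) - ln (n - k)) \<le> (n - k) * ((m - 1) * x / (n - k) - 1)"
    using nk by (intro mult_left_mono) auto
  also have "\<dots> = - t"
    using nk by (simp add: right_diff_distrib n t_def) (simp add: algebra_simps)
  finally have k2: "(n - k) * (ln ((m - 1) * x) - ln (n - k)) \<le> - t" .
  \<comment> \<open>\<open>x / k - 1 = t / k\<close>, and \<open>k \<ge> 1\<close>.\<close>
  have "x / k - 1 \<le> t"
    using assms t mult_right_mono[of 1 k t] by (simp add: x_eq field_simps)
  then have "ln x - ln k \<le> t"
    using \<open>ln x - ln k \<le> x / k - 1\<close> by linarith
  moreover have "ln ((m - 1) * x) \<le> ln (n - k)"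
    using nk by simp
  moreover have "t / 2 \<le> t * ln (m - 1)"
  proof -
    have "1 / 2 \<le> ln (2::real)" using ln2_ge_two_thirds by simp
    also have "\<dots> \<le> ln (m - 1)" using assms by simp
    finally show ?thesis using mult_left_mono[OF _ t] by fastforce
  qed
  \<comment> \<open>The left side is the logarithmic excess of the square root part at
    \<open>k\<close> over the one at \<open>x\<close>.\<close>
  ultimately have root: "(ln x - ln k + ln ((m - 1) * x) - ln (n - k)) / 2 \<le> t * ln (m - 1)"
    by simp
  \<comment> \<open>The target carries \<open>ln (m - 1)\<close> with weight
    \<open>- (n - k - t)\<close>, Gibbs' inequality yields \<open>- (n - k)\<close>. The difference
    \<open>t * ln (m - 1)\<close> is the room that absorbs \<open>root\<close>.\<close>
  have "n * ((m - 1) / m) = n - k - t"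
    using assms by (simp add: n t_def field_simps)
  then have "n * (ln m - (m - 1) / m * ln (m - 1)) = n * ln m - (n - k - t) * ln (m - 1)"
    by (metis mult.assoc right_diff_distrib)
  then show ?thesis
    using k1 k2 root unfolding ln_n ln_nx
    by (simp add: algebra_simps add_divide_distrib diff_divide_distrib)
qed

theorem theorem2p3:
  fixes m n :: nat
  assumes "m \<ge> 3" and "n \<ge> 3" and "n \<ge> 2 * m - 1"
  shows "real (n choose nat \<lfloor>real n / real m\<rfloor>)
    < real m / sqrt (2 * pi * (real m - 1) * real n)
      * (real m / (real m - 1) powr ((real m - 1) / real m)) ^ n"
proof -
  define k where "k = n div m"
  have k_eq: "nat \<lfloor>real n / real m\<rfloor> = k"
    by (simp add: k_def floor_divide_of_nat_eq)
  have "m \<le> n" using assms by linarith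
  \<comment> \<open>The Stirling bound needs both \<open>k\<close> and \<open>n - k\<close>
    positive, and \<open>k \<ge> 1\<close> also enters the estimate of the square root part.\<close>
  then have k: "k \<ge> 1" "k < n"
    using assms by (auto simp: k_def div_greater_zero_iff Suc_le_eq)
  have k_le: "real k \<le> real n / real m"
    by (simp add: k_def of_nat_div_le_of_nat)
  define R where "R = real m / sqrt (2 * pi * (real m - 1) * real n)
      * (real m / (real m - 1) powr ((real m - 1) / real m)) ^ n"
  have pos: "real m > 0" "real m - 1 > 0" "real n > 0" using assms by auto
  have ln_R: "ln R = ln m - (ln (2 * pi) + ln (real m - 1) + ln n) / 2
      + n * (ln m - (real m - 1) / m * ln (real m - 1))"
    unfolding R_def using pos
    by (simp add: ln_mult ln_div ln_realpow ln_sqrt ln_powr)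
  \<comment> \<open>The strictness comes from the binomial bound, which also supplies the term
    \<open>ln (2 * pi) / 2\<close>.\<close>
  have "ln (real (n choose k)) < ln R"
    using ln_binomial_less_stirling[of k n] stirling_exponent_le[of "real m" "real k" "real n"]
      k k_le assms(1) unfolding ln_R by (simp add: of_nat_diff add_divide_distrib)
  moreover have "R > 0" unfolding R_def using pos by simp
  moreover have "real (n choose k) > 0" using k by simp
  ultimately have "real (n choose k) < R" by (simp only: ln_less_cancel_iff)
  then show ?thesis unfolding k_eq R_def .
qed

end
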